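(* Let $Z=z_1e_1+z_2e_2$, $\mathcal{V}=\nu_1e_1+\nu_2e_2=\alpha+j\beta$, $C=c_1e_1+c_2e_2$, $M=m_1e_1+m_2e_2\in\mathbb{BC}$, where $m_1,m_2$ are positive integers, and let $k\in\mathbb{N}$ be a positive integer. Then $$\frac{d^k}{dZ^k}\left(E_{\mathcal{V}+M,C}(Z)\right)=E_{\mathcal{V}+M-k,C}(Z).$$
   Context: Bicomplex numbers: $\mathbb{BC}=\{w_1+jw_2: w_1,w_2\in\mathbb{C}(i)\}$, where $\mathbb{C}(i)$ is the complex field with unit $i$, $i^2=j^2=-1$, $ij=ji$. Put $e_1=\frac{1+ij}{2}$, $e_2=\frac{1-ij}{2}$, so $e_1+e_2=1$, $e_l^2=e_l$, $e_1e_2=0$. Every $Z=w_1+jw_2$ is uniquely $Z=z_1e_1+z_2e_2$ with $z_1=w_1-iw_2$, $z_2=w_1+iw_2\in\mathbb{C}(i)$, and addition, multiplication and division are componentwise in $e_1,e_2$. Functions act componentwise: $\Gamma(Y)=\Gamma(y_1)e_1+\Gamma(y_2)e_2$ for $Y=y_1e_1+y_2e_2$ (with $1/\Gamma$ equal to $0$ at the poles of $\Gamma$), and $Z^{W}=z_1^{w_1}e_1+z_2^{w_2}e_2$ for $Z=z_1e_1+z_2e_2$, $W=w_1e_1+w_2e_2$ (principal complex powers; usual powers with $0^0=1$ for integer exponents). Identities are understood for $Z$ at which the occurring powers are defined and holomorphic (e.g. $z_1,z_2\notin(-\infty,0]$). Bicomplex Miller-Ross function: $E_{\mathcal{V},C}(Z)=Z^{\mathcal{V}}\sum_{r=0}^{\infty}\frac{(CZ)^r}{\Gamma(\mathcal{V}+r+1)}$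 for $\mathcal{V},C,Z\in\mathbb{BC}$. Bicomplex derivative: $\frac{df}{dZ}(Z_0)=\lim\frac{f(Z_0+\Delta Z)-f(Z_0)}{\Delta Z}$ as $\Delta Z\to0$ through non-zero-divisors; for $f(Z)=f_1(z_1)e_1+f_2(z_2)e_2$ with $f_1,f_2$ holomorphic it equals $f_1'(z_1)e_1+f_2'(z_2)e_2$. *)

theory Defs
  imports "HOL-Analysis.Analysis"
begin

section \<open>Bicomplex numbers\<close>

text \<open>\<open>Bicomplex w1 w2\<close> stands for $w_1 + j w_2$.\<close>

datatype bicomplex = Bicomplex (bc_w1: complex) (bc_w2: complex)

lemma bc_eq_iff: "Z = W \<longleftrightarrow> bc_w1 Z = bc_w1 W \<and> bc_w2 Z = bc_w2 W"
  by (cases Z; cases W) auto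

instantiation bicomplex :: comm_ring_1
begin

definition "0 = Bicomplex 0 0"
definition "1 = Bicomplex 1 0"
definition "Z + W = Bicomplex (bc_w1 Z + bc_w1 W) (bc_w2 Z + bc_w2 W)"
definition "Z - W = Bicomplex (bc_w1 Z - bc_w1 W) (bc_w2 Z - bc_w2 W)"
definition "- Z = Bicomplex (- bc_w1 Z) (- bc_w2 Z)"
definition "Z * W = Bicomplex (bc_w1 Z * bc_w1 W - bc_w2 Z * bc_w2 W)
                              (bc_w1 Z * bc_w2 W + bc_w2 Z * bc_w1 W)"

instance
  by standard
    (auto simp: bc_eq_iff zero_bicomplex_def one_bicomplex_def plus_bicomplex_def
      minus_bicomplex_def uminus_bicomplex_def times_bicomplex_def algebra_simps)

end

instantiation bicomplex :: real_vector
begin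

definition "scaleR r Z = Bicomplex (scaleR r (bc_w1 Z)) (scaleR r (bc_w2 Z))"

instance
  by standard
    (auto simp: bc_eq_iff plus_bicomplex_def scaleR_bicomplex_def scaleR_add_right scaleR_add_left)

end

instantiation bicomplex :: real_normed_vector
begin

definition "norm Z = sqrt ((norm (bc_w1 Z))\<^sup>2 + (norm (bc_w2 Z))\<^sup>2)"
definition "sgn (Z :: bicomplex) = Z /\<^sub>R norm Z"
definition "dist (Z :: bicomplex) W = norm (Z - W)"
definition [code del]:
  "(uniformity :: (bicomplex \<times> bicomplex) filter) = (INF e\<in>{0 <..}. principal {(x, y). dist x y < e})"
definition [code del]:
  "open (U :: bicomplex set) \<longleftrightarrow> (\<forall>x\<in>U. eventually (\<lambda>(x', y). x' = x \<longrightarrow> y \<in> U) uniformity)"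

instance
proof
  fix Z W :: bicomplex and a :: real and U :: "bicomplex set"
  show "dist Z W = norm (Z - W)" "sgn Z = Z /\<^sub>R norm Z"
    by (simp_all add: dist_bicomplex_def sgn_bicomplex_def)
  show "(uniformity :: (bicomplex \<times> bicomplex) filter) = (INF e\<in>{0 <..}. principal {(x, y). dist x y < e})"
    by (rule uniformity_bicomplex_def)
  show "open U \<longleftrightarrow> (\<forall>x\<in>U. \<forall>\<^sub>F (x', y) in uniformity. x' = x \<longrightarrow> y \<in> U)"
    by (rule open_bicomplex_def)
  show "(norm Z = 0) = (Z = 0)"
    by (auto simp: norm_bicomplex_def bc_eq_iff zero_bicomplex_def add_nonneg_eq_0_iff)
  show "norm (a *\<^sub>R Z) = \<bar>a\<bar> * norm Z"
    by (simp add: norm_bicomplex_def scaleR_bicomplex_def power_mult_distrib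
        real_sqrt_mult flip: distrib_left)
  have "norm (Z + W) \<le> sqrt ((norm (bc_w1 Z) + norm (bc_w1 W))\<^sup>2 + (norm (bc_w2 Z) + norm (bc_w2 W))\<^sup>2)"
    unfolding norm_bicomplex_def plus_bicomplex_def
    by (auto intro!: real_sqrt_le_mono add_mono power_mono norm_triangle_ineq)
  also have "\<dots> \<le> norm Z + norm W"
    unfolding norm_bicomplex_def by (rule real_sqrt_sum_squares_triangle_ineq)
  finally show "norm (Z + W) \<le> norm Z + norm W" .
qed

end

subsection \<open>Idempotent representation\<close>

definition bc_of_complex :: "complex \<Rightarrow> bicomplex" where
  "bc_of_complex w = Bicomplex w 0"

definition bc_j :: bicomplex where
  "bc_j = Bicomplex 0 1"

definition bc_e1 :: bicomplex where
  "bc_e1 = (1 + bc_of_complex \<i> * bc_j) /\<^sub>R 2"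

definition bc_e2 :: bicomplex where
  "bc_e2 = (1 - bc_of_complex \<i> * bc_j) /\<^sub>R 2"

definition bc_idem :: "complex \<Rightarrow> complex \<Rightarrow> bicomplex" where
  "bc_idem z1 z2 = bc_of_complex z1 * bc_e1 + bc_of_complex z2 * bc_e2"

definition bc_z1 :: "bicomplex \<Rightarrow> complex" where
  "bc_z1 Z = bc_w1 Z - \<i> * bc_w2 Z"

definition bc_z2 :: "bicomplex \<Rightarrow> complex" where
  "bc_z2 Z = bc_w1 Z + \<i> * bc_w2 Z"

lemmas bc_basic_defs = zero_bicomplex_def one_bicomplex_def plus_bicomplex_def
  minus_bicomplex_def uminus_bicomplex_def times_bicomplex_def scaleR_bicomplex_def
  bc_of_complex_def bc_j_def bc_e1_def bc_e2_def bc_idem_def bc_z1_def bc_z2_def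

lemma bicomplex_eq: "Bicomplex w1 w2 = bc_of_complex w1 + bc_j * bc_of_complex w2"
  by (simp add: bc_basic_defs)

lemma bc_j_square: "bc_j * bc_j = -1"
  by (simp add: bc_basic_defs)

lemma bc_z_idem [simp]: "bc_z1 (bc_idem z1 z2) = z1" "bc_z2 (bc_idem z1 z2) = z2"
  by (simp_all add: bc_basic_defs algebra_simps scaleR_conv_of_real)

lemma bc_idem_z [simp]: "bc_idem (bc_z1 Z) (bc_z2 Z) = Z"
  by (simp add: bc_basic_defs algebra_simps bc_eq_iff scaleR_conv_of_real)

lemma bc_z_ring [simp]:
  "bc_z1 0 = 0" "bc_z2 0 = 0" "bc_z1 1 = 1" "bc_z2 1 = 1"
  "bc_z1 (Z + W) = bc_z1 Z + bc_z1 W" "bc_z2 (Z + W) = bc_z2 Z + bc_z2 W"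
  "bc_z1 (Z - W) = bc_z1 Z - bc_z1 W" "bc_z2 (Z - W) = bc_z2 Z - bc_z2 W"
  "bc_z1 (Z * W) = bc_z1 Z * bc_z1 W" "bc_z2 (Z * W) = bc_z2 Z * bc_z2 W"
  by (simp_all add: bc_basic_defs algebra_simps)

text \<open>As everywhere in the library, \<open>x / 0 = 0\<close>; here this applies to each idempotent component.\<close>

instantiation bicomplex :: inverse
begin

definition "inverse Z = bc_idem (inverse (bc_z1 Z)) (inverse (bc_z2 Z))"
definition "Z div W = bc_idem (bc_z1 Z / bc_z1 W) (bc_z2 Z / bc_z2 W)"

instance ..

end

subsection \<open>Bicomplex derivative\<close>

text \<open>Zero counts as a zero divisor here.\<close>

definition bc_zero_divisor :: "bicomplex \<Rightarrow> bool" where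
  "bc_zero_divisor H \<longleftrightarrow> (\<exists>W. W \<noteq> 0 \<and> H * W = 0)"

lemma bc_zero_divisor_iff: "bc_zero_divisor H \<longleftrightarrow> bc_z1 H = 0 \<or> bc_z2 H = 0"
proof
  assume "bc_zero_divisor H"
  then obtain W where W: "W \<noteq> 0" "H * W = 0"
    by (auto simp: bc_zero_divisor_def)
  have "bc_z1 H * bc_z1 W = 0" "bc_z2 H * bc_z2 W = 0"
    using arg_cong[OF W(2), of bc_z1] arg_cong[OF W(2), of bc_z2] by simp_all
  moreover have "bc_z1 W \<noteq> 0 \<or> bc_z2 W \<noteq> 0"
    using W(1) bc_idem_z[of W] bc_idem_z[of 0] by force
  ultimately show "bc_z1 H = 0 \<or> bc_z2 H = 0" by auto
next
  assume *: "bc_z1 H = 0 \<or> bc_z2 H = 0"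
  have "H * bc_idem 1 0 = bc_idem (bc_z1 H) 0" "H * bc_idem 0 1 = bc_idem 0 (bc_z2 H)"
    by (metis bc_idem_z bc_z_idem bc_z_ring(9,10) mult.right_neutral mult_zero_right)+
  moreover have "bc_idem 0 0 = 0" "bc_idem 1 0 \<noteq> 0" "bc_idem 0 1 \<noteq> 0"
    using bc_idem_z[of 0] bc_z_idem[of 1 0] bc_z_idem[of 0 1] by (auto simp del: bc_z_idem)
  ultimately show "bc_zero_divisor H"
    using * unfolding bc_zero_divisor_def by metis
qed

definition has_bc_derivative :: "(bicomplex \<Rightarrow> bicomplex) \<Rightarrow> bicomplex \<Rightarrow> bicomplex \<Rightarrow> bool" where
  "has_bc_derivative f D Z \<longleftrightarrow>
     ((\<lambda>H. (f (Z + H) - f Z) / H) \<longlongrightarrow> D) (at 0 within {H. \<not> bc_zero_divisor H})"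

definition bc_differentiable :: "(bicomplex \<Rightarrow> bicomplex) \<Rightarrow> bicomplex \<Rightarrow> bool" where
  "bc_differentiable f Z \<longleftrightarrow> (\<exists>D. has_bc_derivative f D Z)"

definition bc_deriv :: "(bicomplex \<Rightarrow> bicomplex) \<Rightarrow> bicomplex \<Rightarrow> bicomplex" where
  "bc_deriv f Z = (THE D. has_bc_derivative f D Z)"

subsection \<open>Powers and the Gamma function\<close>

text \<open>
  Principal power; for an integer exponent the usual power, so that \<open>cpow 0 0 = 1\<close>
  (whereas \<open>0 powr 0 = 0\<close>).
\<close>

definition cpow :: "complex \<Rightarrow> complex \<Rightarrow> complex" where
  "cpow z w = (if w \<in> \<int> then z powi \<lfloor>Re w\<rfloor> else z powr w)"

lemma cpow_analytic_iff:
  "(\<lambda>z. cpow z w) analytic_on {z0} \<longleftrightarrow> z0 \<notin> \<real>\<^sub>\<le>\<^sub>0 \<or> w \<in> \<int> \<and> z0 \<noteq> 0 \<or> w \<in> \<nat>"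
proof
  assume "z0 \<notin> \<real>\<^sub>\<le>\<^sub>0 \<or> w \<in> \<int> \<and> z0 \<noteq> 0 \<or> w \<in> \<nat>"
  then consider "w \<in> \<nat>" | "w \<in> \<int>" "z0 \<noteq> 0" | "w \<notin> \<int>" "z0 \<notin> \<real>\<^sub>\<le>\<^sub>0"
    by fastforce
  then show "(\<lambda>z. cpow z w) analytic_on {z0}"
  proof cases
    case 1
    then obtain n where "w = of_nat n" by (auto elim: Nats_cases)
    then have "(\<lambda>z. cpow z w) = (\<lambda>z. z ^ n)"
      by (auto simp: cpow_def power_int_def)
    then show ?thesis by (auto intro!: analytic_intros)
  next
    case 2
    then have "(\<lambda>z. cpow z w) = (\<lambda>z. z powi \<lfloor>Re w\<rfloor>)" by (auto simp: cpow_def)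
    with 2 show ?thesis by (auto intro!: analytic_intros)
  next
    case 3
    then have "(\<lambda>z. cpow z w) = (\<lambda>z. z powr w)" by (auto simp: cpow_def)
    moreover have "(\<lambda>z. z powr w) holomorphic_on - \<real>\<^sub>\<le>\<^sub>0"
      by (auto intro!: holomorphic_intros)
    ultimately show ?thesis
      using 3 by (subst analytic_at) (metis closed_nonpos_Reals_complex open_Compl ComplI)
  qed
next
  assume an: "(\<lambda>z. cpow z w) analytic_on {z0}"
  have int: "w \<in> \<int>" if z0: "z0 \<in> \<real>\<^sub>\<le>\<^sub>0"
  proof (rule ccontr)
    assume w: "w \<notin> \<int>"
    then have cpow: "cpow z w = z powr w" for z by (simp add: cpow_def)
    from an obtain r where r: "r > 0" "(\<lambda>z. cpow z w) holomorphic_on ball z0 r"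
      by (auto simp: analytic_on_def)
    define x where "x = z0 - of_real (r / 2)"
    from z0 obtain t where t: "z0 = of_real t" "t \<le> 0" by (auto elim: nonpos_Reals_cases)
    have x: "Re x < 0" "Im x = 0" "x \<in> ball z0 r"
      using t r(1) by (auto simp: x_def dist_norm)
    have cont: "isCont (\<lambda>z. z powr w) x"
      using holomorphic_on_imp_continuous_on[OF r(2)] x(3)
      by (auto simp: cpow continuous_on_eq_continuous_at)
    define q where "q = (\<lambda>z. z powr w / exp (w * Ln (- z)))"
    have "- x \<notin> \<real>\<^sub>\<le>\<^sub>0" using x by (auto simp: complex_nonpos_Reals_iff)
    then have "isCont q x"
      unfolding q_def by (auto intro!: continuous_intros cont)
    moreover have "(\<lambda>n. x - \<i> * of_real (inverse (real (Suc n)))) \<longlonglongrightarrow> x - \<i> * of_real 0"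
      by (intro tendsto_intros LIMSEQ_inverse_real_of_nat)
    ultimately have "(\<lambda>n. q (x - \<i> * of_real (inverse (real (Suc n))))) \<longlonglongrightarrow> q x"
      by (auto intro: isCont_tendsto_compose)
    moreover have "q (x - \<i> * of_real (inverse (real (Suc n)))) = exp (- (\<i> * pi * w))" for n
    proof -
      define y where "y = x - \<i> * of_real (inverse (real (Suc n)))"
      have y: "Im y < 0" "y \<noteq> 0" using x by (auto simp: y_def)
      then have "Ln (- y) = Ln y + \<i> * pi" by (simp add: Ln_minus)
      then have "q y = exp (- (\<i> * pi * w))"
        using y(2) by (simp add: q_def powr_def flip: exp_diff) (simp add: algebra_simps)
      then show ?thesis by (simp only: y_def)
    qed
    moreover have "q x = exp (\<i> * pi * w)"
    proof -
      have "x \<noteq> 0" using x by auto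
      moreover have "Ln (- x) = Ln x - \<i> * pi" using x \<open>x \<noteq> 0\<close> by (simp add: Ln_minus)
      ultimately show ?thesis
        by (simp add: q_def powr_def flip: exp_diff) (simp add: algebra_simps)
    qed
    ultimately have "exp (- (\<i> * pi * w)) = exp (\<i> * pi * w)"
      by (simp add: LIMSEQ_const_iff)
    then obtain n :: int where "\<i> * pi * w = - (\<i> * pi * w) + (of_int (2 * n) * pi) * \<i>"
      using exp_eq[of "\<i> * pi * w" "- (\<i> * pi * w)"] by auto
    then have "\<i> * (2 * pi) * w = \<i> * (2 * pi) * of_int n" by (simp add: algebra_simps)
    then have "w = of_int n" by simp
    with w show False by simp
  qed
  have "w \<in> \<nat>" if "w \<in> \<int>" "z0 = 0"
  proof (rule ccontr)
    assume w: "w \<notin> \<nat>"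
    from \<open>w \<in> \<int>\<close> obtain k where k: "w = of_int k" by (auto elim: Ints_cases)
    have "k < 0" using w k by (metis Nats_nonempty not_less of_int_of_nat_eq of_nat_in_Nats zero_le_imp_eq_int)
    define n where "n = nat (- k)"
    have n: "n > 0" "cpow z w = inverse z ^ n" for z
      using \<open>k < 0\<close> by (auto simp: n_def cpow_def k power_int_def)
    have "isCont (\<lambda>z. z ^ n * cpow z w) 0"
      using analytic_at_imp_isCont[OF an] that by (auto intro!: continuous_intros)
    moreover have "(\<lambda>m. complex_of_real (inverse (real (Suc m)))) \<longlonglongrightarrow> of_real 0"
      by (intro tendsto_intros LIMSEQ_inverse_real_of_nat)
    ultimately have "(\<lambda>m. complex_of_real (inverse (real (Suc m))) ^ n *
        cpow (of_real (inverse (real (Suc m)))) w) \<longlonglongrightarrow> 0 ^ n * cpow 0 w"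
      using isCont_tendsto_compose[of 0 "\<lambda>z. z ^ n * cpow z w"] by auto
    moreover have "complex_of_real (inverse (real (Suc m))) ^ n *
        cpow (of_real (inverse (real (Suc m)))) w = 1" for m
      unfolding n(2) power_mult_distrib[symmetric]
      by (subst right_inverse) (auto simp del: of_nat_Suc)
    ultimately show False using n(1) by (simp add: LIMSEQ_const_iff zero_power)
  qed
  with int show "z0 \<notin> \<real>\<^sub>\<le>\<^sub>0 \<or> w \<in> \<int> \<and> z0 \<noteq> 0 \<or> w \<in> \<nat>" by blast
qed

definition bc_pow :: "bicomplex \<Rightarrow> bicomplex \<Rightarrow> bicomplex" where
  "bc_pow Z W = bc_idem (cpow (bc_z1 Z) (bc_z1 W)) (cpow (bc_z2 Z) (bc_z2 W))"

text \<open>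
  The power with exponent \<open>W\<close> is defined and holomorphic at \<open>Z\<close>. The values that \<open>cpow\<close> takes by
  convention where the power is undefined do no harm: \<open>cpow\<close> is not analytic there
  (see \<open>cpow_analytic_iff\<close>).
\<close>

definition bc_pow_holomorphic_at :: "bicomplex \<Rightarrow> bicomplex \<Rightarrow> bool" where
  "bc_pow_holomorphic_at W Z \<longleftrightarrow>
     (\<lambda>z. cpow z (bc_z1 W)) analytic_on {bc_z1 Z} \<and>
     (\<lambda>z. cpow z (bc_z2 W)) analytic_on {bc_z2 Z}"

definition bc_rGamma :: "bicomplex \<Rightarrow> bicomplex" where
  "bc_rGamma Y = bc_idem (rGamma (bc_z1 Y)) (rGamma (bc_z2 Y))"

subsection \<open>The bicomplex Miller-Ross function\<close>

definition miller_ross :: "bicomplex \<Rightarrow> bicomplex \<Rightarrow> bicomplex \<Rightarrow> bicomplex" where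
  "miller_ross V C Z = bc_pow Z V * (\<Sum>r. (C * Z) ^ r * bc_rGamma (V + of_nat r + 1))"

end

theory Submission imports Defs begin

text \<open>
  Everything splits into idempotent components, so it suffices to treat the complex function
  $z^\nu g_\nu(z)$ with the entire series $g_\nu(z) = \sum_r (cz)^r / \Gamma(\nu+r+1)$.
  The recurrence $(\nu+r)/\Gamma(\nu+r+1) = 1/\Gamma(\nu+r)$ gives
  $\nu g_\nu + z g_\nu' = g_{\nu-1}$, so differentiation lowers $\nu$ by one wherever
  $z^\nu$ and $z^{\nu-1}$ are both holomorphic. If $z^\nu$ and $z^{\nu-k}$ are holomorphic at a
  point, then so are all the intermediate powers, on a neighbourhood of that point, which allows
  iteration.
\<close>

section \<open>Complex powers\<close>

text \<open>The criterion \<open>cpow_analytic_iff\<close> is read off by the position of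
  \<open>z0\<close>. Off the cut every exponent works; on the cut away from 0 integrality survives
  integer shifts; at 0 the exponent \<open>w - k\<close> is a natural number, and adding
  \<open>k - n\<close> keeps it one.\<close>

lemma cpow_analytic_intermediate:
  assumes "(\<lambda>z. cpow z w) analytic_on {z0}" "(\<lambda>z. cpow z (w - of_nat k)) analytic_on {z0}" "n \<le> k"
  shows "(\<lambda>z. cpow z (w - of_nat n)) analytic_on {z0}"
proof -
  have int: "w - of_nat n \<in> \<int>" if "w \<in> \<int>"
    using that by auto
  have "w - of_nat n \<in> \<nat>" if "w - of_nat k \<in> \<nat>"
  proof -
    have "w - of_nat n = (w - of_nat k) + of_nat (k - n)"
      using assms(3) by simp
    then show ?thesis using that by (metis Nats_add of_nat_in_Nats)
  qed
  moreover have "w \<in> \<int>" if "w \<in> \<nat>" using that Nats_subset_Ints by blast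
  ultimately show ?thesis
    using assms int unfolding cpow_analytic_iff by auto
qed

lemma cpow_of_nat: "cpow z (of_nat n) = z ^ n"
  by (simp add: cpow_def)

lemma cpow_of_int: "cpow z (of_int n) = z powi n"
  by (simp add: cpow_def)

lemma cpow_eq_mult:
  assumes "(\<lambda>z. cpow z w) analytic_on {z}" "(\<lambda>z. cpow z (w - 1)) analytic_on {z}"
  shows "cpow z w = z * cpow z (w - 1)"
proof -
  \<comment> \<open>The point \<open>z = 0\<close> falls under the first case because holomorphy is
    assumed for \<open>w - 1\<close> too. Holomorphy for \<open>w\<close> alone would admit
    \<open>w = 0\<close>, where \<open>cpow 0 0 = 1\<close> breaks the identity.\<close>
  consider "w - 1 \<in> \<nat>" | "w \<in> \<int>" "z \<noteq> 0" | "w \<notin> \<int>" "z \<notin> \<real>\<^sub>\<le>\<^sub>0"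
    using assms unfolding cpow_analytic_iff by fastforce
  then show ?thesis
  proof cases
    case 1
    then obtain n where "w - 1 = of_nat n" by (auto elim: Nats_cases)
    then have w: "w - 1 = of_nat n" "w = of_nat (Suc n)" by (auto simp: algebra_simps)
    show ?thesis by (simp only: w(1), simp only: w(2) cpow_of_nat power_Suc)
  next
    case 2
    then obtain n where w: "w = of_int n" by (auto elim: Ints_cases)
    then have "w - 1 = of_int (n - 1)" by simp
    then show ?thesis using 2 by (simp add: w cpow_of_int power_int_diff del: of_int_diff)
  next
    case 3
    then have "w - 1 \<notin> \<int>" using Ints_add[of "w - 1" 1] by auto
    moreover have "z \<noteq> 0" using 3 by auto
    ultimately show ?thesis using 3 by (simp add: cpow_def powr_diff)
  qed
qed

lemma has_field_derivative_cpow: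
  assumes "(\<lambda>z. cpow z w) analytic_on {z}"
  shows "((\<lambda>z. cpow z w) has_field_derivative w * cpow z (w - 1)) (at z)"
proof -
  consider "w \<in> \<nat>" | "w \<in> \<int>" "z \<noteq> 0" | "w \<notin> \<int>" "z \<notin> \<real>\<^sub>\<le>\<^sub>0"
    using assms unfolding cpow_analytic_iff by fastforce
  then show ?thesis
  proof cases
    case 1
    then obtain n where w: "w = of_nat n" by (auto elim: Nats_cases)
    show ?thesis
    proof (cases n)
      \<comment> \<open>For \<open>w = 0\<close> the factor \<open>w\<close> annihilates
        \<open>cpow z (w - 1)\<close>, whatever its value at \<open>z = 0\<close>.\<close>
      case 0
      then show ?thesis using w cpow_of_nat[of _ 0] by simp
    next
      case (Suc m)
      then have "w - 1 = of_nat m" using w by simp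
      moreover have "((\<lambda>z. z ^ n) has_field_derivative of_nat n * z ^ m) (at z)"
        using DERIV_power[OF DERIV_ident, where n = n and x = z and s = UNIV] by (simp add: Suc)
      ultimately show ?thesis by (simp only: w cpow_of_nat)
    qed
  next
    case 2
    then obtain n where w: "w = of_int n" by (auto elim: Ints_cases)
    then have w1: "w - 1 = of_int (n - 1)" by simp
    have "((\<lambda>z. z powi n) has_field_derivative of_int n * z powi (n - 1)) (at z)"
      using 2 by (auto intro!: derivative_eq_intros)
    then show ?thesis by (simp only: w1) (simp only: w cpow_of_int)
  next
    case 3
    then have "w - 1 \<notin> \<int>" using Ints_add[of "w - 1" 1] by auto
    with 3 show ?thesis by (simp add: cpow_def has_field_derivative_powr)
  qed
qed

text \<open>A neighbourhood on which \<open>f\<close> is holomorphic witnesses analyticity at each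
  of its points. This supplies the open domain on which derivatives can be iterated.\<close>

lemma open_analytic_points: "open {z. f analytic_on {z}}"
proof (subst open_subopen, safe)
  fix z assume "f analytic_on {z}"
  then obtain S where "open S" "z \<in> S" "f holomorphic_on S" by (auto simp: analytic_at)
  then show "\<exists>T. open T \<and> z \<in> T \<and> T \<subseteq> {z. f analytic_on {z}}"
    by (auto simp: analytic_at)
qed

section \<open>The complex Miller-Ross function\<close>

definition complex_miller_ross :: "complex \<Rightarrow> complex \<Rightarrow> complex \<Rightarrow> complex" where
  "complex_miller_ross v c z = cpow z v * (\<Sum>r. (c * z) ^ r * rGamma (v + of_nat r + 1))"

text \<open>Since \<open>rGamma\<close> is entire and vanishes at the poles of Gamma, the recurrence
  holds without exceptions, so no exponent \<open>v\<close> needs separate treatment.\<close>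

lemma rGamma_shift: "(v + of_nat r) * rGamma (v + of_nat r + 1) = rGamma (v + of_nat r :: complex)"
  by (rule rGamma_plus1)

text \<open>Ratio test: by the recurrence, passing from term \<open>n\<close> to term
  \<open>n + 1\<close> amounts to a factor \<open>x / (v + n + 1)\<close>. The estimate is kept in
  multiplied form, which avoids dividing by terms that may vanish.\<close>

lemma summable_miller_ross:
  fixes v x :: complex
  shows "summable (\<lambda>r. x ^ r * rGamma (v + of_nat r + 1))"
proof -
  \<comment> \<open>This makes \<open>norm (v + of_nat (Suc n))\<close>, which is at least
    \<open>n + 1 - norm v\<close>, no smaller than \<open>2 * norm x\<close> once
    \<open>n \<ge> N\<close>.\<close>
  obtain N :: nat where N: "norm v + 2 * norm x + 1 \<le> real N"
    using real_arch_simple by blast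
  show ?thesis
  proof (rule summable_ratio_test[of "1/2" N])
    fix n assume "N \<le> n"
    then have "norm v + 2 * norm x + 1 \<le> real n" using N by simp
    moreover have "real n + 1 \<le> norm (v + of_nat (Suc n)) + norm v"
      using norm_triangle_ineq4[of "v + of_nat (Suc n)" v]
      by (simp del: of_nat_Suc)
    ultimately have le: "2 * norm x \<le> norm (v + of_nat (Suc n))" by linarith
    have "2 * norm (x ^ Suc n * rGamma (v + of_nat (Suc n) + 1))
        = (2 * norm x) * (norm (x ^ n) * norm (rGamma (v + of_nat (Suc n) + 1)))"
      by (simp add: norm_mult)
    also have "\<dots> \<le> norm (v + of_nat (Suc n)) * (norm (x ^ n) * norm (rGamma (v + of_nat (Suc n) + 1)))"
      using le by (intro mult_right_mono) auto
    also have "\<dots> = norm (x ^ n) * norm ((v + of_nat (Suc n)) * rGamma (v + of_nat (Suc n) + 1))"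
      by (simp add: norm_mult)
    also have "\<dots> = norm (x ^ n * rGamma (v + of_nat n + 1))"
      unfolding rGamma_shift by (simp add: norm_mult add_ac)
    finally show "norm (x ^ Suc n * rGamma (v + of_nat (Suc n) + 1))
        \<le> 1/2 * norm (x ^ n * rGamma (v + of_nat n + 1))" by simp
  qed simp
qed

text \<open>Termwise differentiation followed by multiplication by \<open>z\<close> gives the
  coefficient of \<open>z ^ r\<close> the factor \<open>r\<close>. Adding \<open>v\<close> times the
  series yields the factor \<open>v + r\<close>, which \<open>rGamma_shift\<close> absorbs.\<close>

lemma miller_ross_series_derivative:
  fixes v c z :: complex
  obtains D where
    "((\<lambda>z. \<Sum>r. (c * z) ^ r * rGamma (v + of_nat r + 1)) has_field_derivative D) (at z)"
    "v * (\<Sum>r. (c * z) ^ r * rGamma (v + of_nat r + 1)) + z * D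
       = (\<Sum>r. (c * z) ^ r * rGamma (v - 1 + of_nat r + 1))"
proof -
  define a where "a = (\<lambda>r. c ^ r * rGamma (v + of_nat r + 1))"
  have a: "(c * y) ^ r * rGamma (v + of_nat r + 1) = a r * y ^ r" for y r
    by (simp add: a_def power_mult_distrib)
  have summ: "summable (\<lambda>r. a r * y ^ r)" for y
    using summable_miller_ross[of "c * y" v] by (simp add: a)
  define D where "D = (\<Sum>r. diffs a r * z ^ r)"
  have "((\<lambda>z. \<Sum>r. a r * z ^ r) has_field_derivative D) (at z)"
    unfolding D_def by (rule termdiffs_strong_converges_everywhere) (rule summ)
  moreover have "v * (\<Sum>r. a r * z ^ r) + z * D = (\<Sum>r. (c * z) ^ r * rGamma (v - 1 + of_nat r + 1))"
  proof -
    have "(\<lambda>r. of_nat r * a r * z ^ (r - Suc 0)) sums D"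
      unfolding D_def by (intro diffs_equiv termdiff_converges_all summ)
    then have "(\<lambda>r. z * (of_nat r * a r * z ^ (r - Suc 0))) sums (z * D)"
      by (rule sums_mult)
    \<comment> \<open>At \<open>r = 0\<close> the truncated exponent is harmless, as the factor
      \<open>of_nat r\<close> is zero.\<close>
    moreover have "z * (of_nat r * a r * z ^ (r - Suc 0)) = of_nat r * (a r * z ^ r)" for r
      by (cases r) (auto simp: algebra_simps)
    ultimately have "(\<lambda>r. of_nat r * (a r * z ^ r)) sums (z * D)" by simp
    then have "(\<lambda>r. v * (a r * z ^ r) + of_nat r * (a r * z ^ r)) sums (v * (\<Sum>r. a r * z ^ r) + z * D)"
      by (intro sums_add sums_mult summable_sums summ)
    moreover have "v * (a r * z ^ r) + of_nat r * (a r * z ^ r)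
        = (c * z) ^ r * rGamma (v - 1 + of_nat r + 1)" for r
    proof -
      have "v * (a r * z ^ r) + of_nat r * (a r * z ^ r)
          = (c * z) ^ r * ((v + of_nat r) * rGamma (v + of_nat r + 1))"
        by (simp add: a_def power_mult_distrib algebra_simps)
      then show ?thesis unfolding rGamma_shift by simp
    qed
    ultimately show ?thesis by (simp add: sums_iff)
  qed
  ultimately show thesis using that[of D] by (simp add: a)
qed

lemma has_field_derivative_complex_miller_ross:
  assumes "(\<lambda>z. cpow z v) analytic_on {z}" "(\<lambda>z. cpow z (v - 1)) analytic_on {z}"
  shows "(complex_miller_ross v c has_field_derivative complex_miller_ross (v - 1) c z) (at z)"
proof -
  obtain D where D:
    "((\<lambda>z. \<Sum>r. (c * z) ^ r * rGamma (v + of_nat r + 1)) has_field_derivative D) (at z)"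
    "v * (\<Sum>r. (c * z) ^ r * rGamma (v + of_nat r + 1)) + z * D
       = (\<Sum>r. (c * z) ^ r * rGamma (v - 1 + of_nat r + 1))"
    by (rule miller_ross_series_derivative)
  have "complex_miller_ross v c
      = (\<lambda>z. cpow z v * (\<Sum>r. (c * z) ^ r * rGamma (v + of_nat r + 1)))"
    by (auto simp: complex_miller_ross_def)
  moreover have "complex_miller_ross (v - 1) c z
      = v * cpow z (v - 1) * (\<Sum>r. (c * z) ^ r * rGamma (v + of_nat r + 1)) + D * cpow z v"
    \<comment> \<open>Writing \<open>cpow z v\<close> as \<open>z * cpow z (v - 1)\<close> lets the
      common power be factored out of both terms of the product rule.\<close>
    unfolding complex_miller_ross_def D(2)[symmetric] cpow_eq_mult[OF assms]
    by (simp add: algebra_simps)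
  ultimately show ?thesis
    using DERIV_mult[OF has_field_derivative_cpow[OF assms(1)] D(1)] by simp
qed

section \<open>Idempotent components\<close>

lemma bc_eqI: "bc_z1 X = bc_z1 Y \<Longrightarrow> bc_z2 X = bc_z2 Y \<Longrightarrow> X = Y"
  by (metis bc_idem_z)

lemma bc_z_power [simp]: "bc_z1 (Z ^ n) = bc_z1 Z ^ n" "bc_z2 (Z ^ n) = bc_z2 Z ^ n"
  by (induction n) simp_all

lemma bc_z_of_nat [simp]: "bc_z1 (of_nat n) = of_nat n" "bc_z2 (of_nat n) = of_nat n"
  by (induction n) simp_all

lemma norm_bc_w_le: "norm (bc_w1 Z) \<le> norm Z" "norm (bc_w2 Z) \<le> norm Z"
  by (auto simp: norm_bicomplex_def intro: real_le_rsqrt)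

lemma bounded_linear_bc_z: "bounded_linear bc_z1" "bounded_linear bc_z2"
proof -
  have le: "norm (bc_w1 Z) + norm (bc_w2 Z) \<le> norm Z * 2" for Z
    using norm_bc_w_le[of Z] by simp
  show "bounded_linear bc_z1"
  proof (rule bounded_linear_intro)
    show "norm (bc_z1 Z) \<le> norm Z * 2" for Z
      using norm_triangle_ineq4[of "bc_w1 Z" "\<i> * bc_w2 Z"] le[of Z]
      by (simp add: bc_z1_def norm_mult)
  qed (simp_all add: bc_z1_def scaleR_bicomplex_def plus_bicomplex_def algebra_simps)
  show "bounded_linear bc_z2"
  proof (rule bounded_linear_intro)
    show "norm (bc_z2 Z) \<le> norm Z * 2" for Z
      using norm_triangle_ineq[of "bc_w1 Z" "\<i> * bc_w2 Z"] le[of Z]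
      by (simp add: bc_z2_def norm_mult)
  qed (simp_all add: bc_z2_def scaleR_bicomplex_def plus_bicomplex_def algebra_simps)
qed

lemma bc_idem_add: "bc_idem a b + bc_idem c d = bc_idem (a + c) (b + d)"
  and bc_idem_diff: "bc_idem a b - bc_idem c d = bc_idem (a - c) (b - d)"
  and bc_idem_mult: "bc_idem a b * bc_idem c d = bc_idem (a * c) (b * d)"
  and bc_idem_0: "bc_idem 0 0 = 0"
  by (rule bc_eqI; simp)+

lemma norm_bc_idem_le: "norm (bc_idem a b) \<le> norm a + norm b"
proof -
  \<comment> \<open>The coordinates come from solving \<open>w1 - \<i> * w2 = a\<close> and
    \<open>w1 + \<i> * w2 = b\<close>.\<close>
  have eq: "bc_idem a b = Bicomplex ((a + b) / 2) (\<i> * ((a - b) / 2))"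
    by (rule bc_eqI)
      (simp_all add: bc_z1_def[of "Bicomplex v w" for v w] bc_z2_def[of "Bicomplex v w" for v w],
       simp_all add: field_simps)
  have "norm (bc_idem a b) \<le> norm ((a + b) / 2) + norm (\<i> * ((a - b) / 2))"
    unfolding eq norm_bicomplex_def by (simp add: sqrt_sum_squares_le_sum)
  also have "\<dots> \<le> norm a + norm b"
    using norm_triangle_ineq[of a b] norm_triangle_ineq4[of a b]
    by (simp add: norm_mult norm_divide)
  finally show ?thesis .
qed

lemma tendsto_bc_idem:
  assumes "(f \<longlongrightarrow> a) F" "(g \<longlongrightarrow> b) F"
  shows "((\<lambda>x. bc_idem (f x) (g x)) \<longlongrightarrow> bc_idem a b) F"
proof (rule LIM_zero_cancel, rule tendsto_0_le[where K = 1])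
  have "((\<lambda>x. norm (f x - a) + norm (g x - b)) \<longlongrightarrow> norm (a - a) + norm (b - b)) F"
    by (intro tendsto_intros assms)
  then show "((\<lambda>x. norm (f x - a) + norm (g x - b)) \<longlongrightarrow> 0) F" by simp
  show "\<forall>\<^sub>F x in F. norm (bc_idem (f x) (g x) - bc_idem a b)
      \<le> norm (norm (f x - a) + norm (g x - b)) * 1"
    by (intro always_eventually allI) (simp add: bc_idem_diff norm_bc_idem_le)
qed

lemma sum_bc_idem: "(\<Sum>r\<in>A. bc_idem (f r) (g r)) = bc_idem (\<Sum>r\<in>A. f r) (\<Sum>r\<in>A. g r)"
  by (induction A rule: infinite_finite_induct) (simp_all add: bc_idem_add bc_idem_0)

lemma sums_bc_idem:
  assumes "f sums a" "g sums b"
  shows "(\<lambda>r. bc_idem (f r) (g r)) sums bc_idem a b"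
  using tendsto_bc_idem assms unfolding sums_def sum_bc_idem by blast

text \<open>Both component series converge, so the bicomplex series converges to the pair of their
  sums and its \<open>suminf\<close> is a genuine limit.\<close>

lemma miller_ross_components:
  "miller_ross V C Z = bc_idem (complex_miller_ross (bc_z1 V) (bc_z1 C) (bc_z1 Z))
                               (complex_miller_ross (bc_z2 V) (bc_z2 C) (bc_z2 Z))"
proof -
  have eq: "(C * Z) ^ r * bc_rGamma (V + of_nat r + 1) =
      bc_idem ((bc_z1 C * bc_z1 Z) ^ r * rGamma (bc_z1 V + of_nat r + 1))
              ((bc_z2 C * bc_z2 Z) ^ r * rGamma (bc_z2 V + of_nat r + 1))" for r
    by (rule bc_eqI) (simp_all add: bc_rGamma_def)
  have "(\<lambda>r. (C * Z) ^ r * bc_rGamma (V + of_nat r + 1)) sums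
      bc_idem (\<Sum>r. (bc_z1 C * bc_z1 Z) ^ r * rGamma (bc_z1 V + of_nat r + 1))
              (\<Sum>r. (bc_z2 C * bc_z2 Z) ^ r * rGamma (bc_z2 V + of_nat r + 1))"
    unfolding eq by (intro sums_bc_idem summable_sums summable_miller_ross)
  then show ?thesis
    by (simp add: miller_ross_def bc_pow_def complex_miller_ross_def sums_iff bc_idem_mult)
qed

section \<open>The bicomplex derivative\<close>

text \<open>Increments that are not zero divisors have two nonzero components, so each component
  tends to 0 within the punctured plane and the difference quotient splits into two complex
  ones.\<close>

lemma has_bc_derivative_idem:
  assumes f: "(f has_field_derivative a) (at (bc_z1 Z))" and g: "(g has_field_derivative b) (at (bc_z2 Z))"
  shows "has_bc_derivative (\<lambda>W. bc_idem (f (bc_z1 W)) (g (bc_z2 W))) (bc_idem a b) Z"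
proof -
  let ?F = "at (0 :: bicomplex) within {H. \<not> bc_zero_divisor H}"
  have ev: "\<forall>\<^sub>F H in ?F. bc_z1 H \<noteq> 0" "\<forall>\<^sub>F H in ?F. bc_z2 H \<noteq> 0"
    by (auto simp: eventually_at_filter bc_zero_divisor_iff)
  have "(bc_z1 \<longlongrightarrow> bc_z1 0) ?F" "(bc_z2 \<longlongrightarrow> bc_z2 0) ?F"
    by (rule bounded_linear_bc_z[THEN bounded_linear.tendsto] tendsto_ident_at)+
  then have lim: "filterlim bc_z1 (at 0) ?F" "filterlim bc_z2 (at 0) ?F"
    using ev by (auto simp: filterlim_at)
  have "((\<lambda>H. bc_idem ((f (bc_z1 Z + bc_z1 H) - f (bc_z1 Z)) / bc_z1 H)
      ((g (bc_z2 Z + bc_z2 H) - g (bc_z2 Z)) / bc_z2 H)) \<longlongrightarrow> bc_idem a b) ?F"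
    using f g unfolding DERIV_def
    by (intro tendsto_bc_idem) (auto intro: filterlim_compose lim)
  then show ?thesis
    by (simp add: has_bc_derivative_def divide_bicomplex_def bc_idem_diff)
qed

text \<open>Needed for uniqueness of limits, and hence for the \<open>THE\<close> in
  \<open>bc_deriv\<close> to pick the derivative.\<close>

lemma nontrivial_limit_bc_units: "at (0 :: bicomplex) within {H. \<not> bc_zero_divisor H} \<noteq> bot"
proof -
  have "\<exists>H\<in>{H. \<not> bc_zero_divisor H}. H \<noteq> 0 \<and> dist H 0 < e" if "e > 0" for e :: real
  proof -
    \<comment> \<open>With both components equal to \<open>e / 3\<close>,
      \<open>norm_bc_idem_le\<close> bounds the norm by \<open>2 * e / 3 < e\<close>.\<close>
    define H where "H = bc_idem (of_real (e / 3)) (of_real (e / 3))"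
    have "norm H < e"
      using norm_bc_idem_le[of "of_real (e / 3)" "of_real (e / 3)"] that by (simp add: H_def)
    moreover have "\<not> bc_zero_divisor H" using that by (simp add: bc_zero_divisor_iff H_def)
    moreover from this have "H \<noteq> 0" by (auto simp: bc_zero_divisor_iff)
    ultimately show ?thesis by (intro bexI[of _ H]) (simp_all add: dist_norm)
  qed
  then show ?thesis by (simp add: trivial_limit_within islimpt_approachable)
qed

lemma bc_deriv_eq:
  assumes "has_bc_derivative f D Z"
  shows "bc_deriv f Z = D"
  unfolding bc_deriv_def
proof (rule the_equality)
  show "has_bc_derivative f D Z" by (rule assms)
next
  fix D' assume "has_bc_derivative f D' Z"
  with assms show "D' = D"
    unfolding has_bc_derivative_def using tendsto_unique[OF nontrivial_limit_bc_units] by blast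
qed

text \<open>Small increments keep \<open>Z + H\<close> inside the open set, so the difference
  quotients eventually coincide.\<close>

lemma has_bc_derivative_transform:
  assumes "has_bc_derivative f D Z" "open S" "Z \<in> S" "\<And>W. W \<in> S \<Longrightarrow> f W = g W"
  shows "has_bc_derivative g D Z"
proof -
  let ?F = "at (0 :: bicomplex) within {H. \<not> bc_zero_divisor H}"
  have "((\<lambda>H. Z + H) \<longlongrightarrow> Z + 0) ?F" by (intro tendsto_intros)
  then have "\<forall>\<^sub>F H in ?F. Z + H \<in> S"
    using assms(2,3) by (auto intro: topological_tendstoD)
  then have "\<forall>\<^sub>F H in ?F. (f (Z + H) - f Z) / H = (g (Z + H) - g Z) / H"
    by eventually_elim (simp add: assms(3,4))
  with assms(1) show ?thesis
    unfolding has_bc_derivative_def by (rule Lim_transform_eventually)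
qed

lemma open_bc_pow_holomorphic: "open {Z. bc_pow_holomorphic_at W Z}"
proof -
  have "open (bc_z1 -` {z. (\<lambda>z. cpow z (bc_z1 W)) analytic_on {z}} \<inter>
      bc_z2 -` {z. (\<lambda>z. cpow z (bc_z2 W)) analytic_on {z}})"
    by (intro open_Int open_vimage open_analytic_points
        bounded_linear.continuous_on[OF bounded_linear_bc_z(1)]
        bounded_linear.continuous_on[OF bounded_linear_bc_z(2)] continuous_on_id)
  then show ?thesis by (simp add: bc_pow_holomorphic_at_def vimage_def Collect_conj_eq)
qed

lemma bc_pow_holomorphic_at_intermediate:
  assumes "bc_pow_holomorphic_at W Z" "bc_pow_holomorphic_at (W - of_nat k) Z" "n \<le> k"
  shows "bc_pow_holomorphic_at (W - of_nat n) Z"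
  using assms cpow_analytic_intermediate[of _ _ k n] by (auto simp: bc_pow_holomorphic_at_def)

lemma has_bc_derivative_miller_ross:
  assumes "bc_pow_holomorphic_at V Z" "bc_pow_holomorphic_at (V - 1) Z"
  shows "has_bc_derivative (miller_ross V C) (miller_ross (V - 1) C Z) Z"
proof -
  have "has_bc_derivative (\<lambda>W. bc_idem (complex_miller_ross (bc_z1 V) (bc_z1 C) (bc_z1 W))
      (complex_miller_ross (bc_z2 V) (bc_z2 C) (bc_z2 W)))
    (bc_idem (complex_miller_ross (bc_z1 V - 1) (bc_z1 C) (bc_z1 Z))
      (complex_miller_ross (bc_z2 V - 1) (bc_z2 C) (bc_z2 Z))) Z"
    using assms by (intro has_bc_derivative_idem has_field_derivative_complex_miller_ross)
      (auto simp: bc_pow_holomorphic_at_def)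
  then show ?thesis by (simp only: miller_ross_components[abs_def] bc_z_ring)
qed

text \<open>The iterates of \<open>bc_deriv\<close> are known to agree with \<open>F n\<close> only
  on \<open>S\<close>. Openness of \<open>S\<close> makes this enough for the next derivative at
  each point of \<open>S\<close>, so the induction runs over all points of \<open>S\<close> at
  once.\<close>

lemma
  fixes F :: "nat \<Rightarrow> bicomplex \<Rightarrow> bicomplex"
  assumes S: "open S"
    and F: "\<And>n Z. n < k \<Longrightarrow> Z \<in> S \<Longrightarrow> has_bc_derivative (F n) (F (Suc n) Z) Z"
  shows bc_deriv_funpow: "n \<le> k \<Longrightarrow> Z \<in> S \<Longrightarrow> (bc_deriv ^^ n) (F 0) Z = F n Z"
    and has_bc_derivative_funpow:
      "n < k \<Longrightarrow> Z \<in> S \<Longrightarrow> has_bc_derivative ((bc_deriv ^^ n) (F 0)) (F (Suc n) Z) Z"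
proof -
  have step: "has_bc_derivative ((bc_deriv ^^ n) (F 0)) (F (Suc n) Z) Z"
    if "n < k" "Z \<in> S" "\<And>W. W \<in> S \<Longrightarrow> (bc_deriv ^^ n) (F 0) W = F n W" for n Z
    using F[OF that(1,2)] S that(2) by (rule has_bc_derivative_transform) (simp add: that(3))
  have eq: "(bc_deriv ^^ n) (F 0) Z = F n Z" if "n \<le> k" "Z \<in> S" for n Z
    using that
  proof (induction n arbitrary: Z)
    case (Suc n)
    then have "has_bc_derivative ((bc_deriv ^^ n) (F 0)) (F (Suc n) Z) Z"
      by (intro step) auto
    then show ?case by (simp add: bc_deriv_eq)
  qed simp
  show "n \<le> k \<Longrightarrow> Z \<in> S \<Longrightarrow> (bc_deriv ^^ n) (F 0) Z = F n Z"
    by (rule eq)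
  show "n < k \<Longrightarrow> Z \<in> S \<Longrightarrow> has_bc_derivative ((bc_deriv ^^ n) (F 0)) (F (Suc n) Z) Z"
    by (rule step) (auto intro: eq)
qed

theorem theorem4p2:
  fixes V C M Z :: bicomplex and m1 m2 k :: nat
  assumes "m1 > 0" and "m2 > 0"
    and "M = of_nat m1 * bc_e1 + of_nat m2 * bc_e2"
    and "k > 0"
    and "bc_pow_holomorphic_at (V + M) Z"
    and "bc_pow_holomorphic_at (V + M - of_nat k) Z"
  shows "(\<forall>n<k. bc_differentiable ((bc_deriv ^^ n) (miller_ross (V + M) C)) Z) \<and>
         (bc_deriv ^^ k) (miller_ross (V + M) C) Z = miller_ross (V + M - of_nat k) C Z"
proof -
  define F where "F = (\<lambda>n :: nat. miller_ross (V + M - of_nat n) C)"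
  \<comment> \<open>Only the two extreme exponents are imposed; the intermediate ones follow at
    every point of \<open>S\<close>. Openness is what permits iterating beyond the single point
    \<open>Z\<close>.\<close>
  define S where
    "S = {W. bc_pow_holomorphic_at (V + M) W} \<inter> {W. bc_pow_holomorphic_at (V + M - of_nat k) W}"
  have S: "open S" "Z \<in> S"
    using assms(5,6) by (auto simp: S_def intro!: open_Int open_bc_pow_holomorphic)
  have F: "has_bc_derivative (F n) (F (Suc n) W) W" if "n < k" "W \<in> S" for n W
  proof -
    have Suc: "V + M - of_nat (Suc n) = V + M - of_nat n - 1" by simp
    show ?thesis
      using that bc_pow_holomorphic_at_intermediate[of "V + M" W k n]
        bc_pow_holomorphic_at_intermediate[of "V + M" W k "Suc n"]
        has_bc_derivative_miller_ross[of "V + M - of_nat n" W C]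
      unfolding F_def S_def Suc by simp
  qed
  have F0: "F 0 = miller_ross (V + M) C" by (simp add: F_def)
  show ?thesis
  proof (intro conjI allI impI)
    fix n assume "n < k"
    then show "bc_differentiable ((bc_deriv ^^ n) (miller_ross (V + M) C)) Z"
      using has_bc_derivative_funpow[of S k F, OF S(1) F _ S(2)]
      unfolding bc_differentiable_def F0 by blast
  next
    show "(bc_deriv ^^ k) (miller_ross (V + M) C) Z = miller_ross (V + M - of_nat k) C Z"
      using bc_deriv_funpow[of S k F, OF S(1) F order_refl S(2)] unfolding F0 by (simp add: F_def)
  qed
qed

end
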